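(* Let $\mathcal M_X=(\mathcal S_X,\Theta_X,\vec\pi_X)$ and $\mathcal M_Y=(\mathcal S_Y,\Theta_Y,\vec\pi_Y)$ be finite statistical models, let $H_{0,X}\subseteq\Theta_X$, $x_1\in\Theta_X\setminus H_{0,X}$, and $0<\alpha<1$. Suppose $\Lambda_X$ is a (level-$\alpha$) least favorable distribution for the composite vs. simple test $H_{0,X}$ vs. $x_1$ under $\mathcal M_X$. For any $y_1\in\Theta_Y$, let $\Lambda^*$ be the distribution over $H_{0,X}\times\Theta_Y$ with $\Lambda^*(x,y_1)=\Lambda_X(x)$ for all $x\in H_{0,X}$ (and $\Lambda^*(x,y)=0$ for $y\neq y_1$). Then $\Lambda^*$ is a (level-$\alpha$) least favorable distribution for $H_{0,X}\times\Theta_Y$ vs. $(x_1,y_1)$ under $\mathcal M_X\otimes\mathcal M_Y$.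
   Context: A statistical model $(\mathcal S,\Theta,\vec\pi)$ consists of a sample space $\mathcal S$, a parameter space $\Theta$ and probability distributions $\pi_\theta$ on $\mathcal S$ for $\theta\in\Theta$; it is finite if $\mathcal S$ and $\Theta$ are finite. The combined model $\mathcal M_X\otimes\mathcal M_Y$ has sample space $\mathcal S_X\times\mathcal S_Y$, parameter space $\Theta_X\times\Theta_Y$, and $\pi_{(\theta_X,\theta_Y)}(P_X,P_Y)=\pi_{\theta_X}(P_X)\cdot\pi_{\theta_Y}(P_Y)$. For a model, $H_0\subseteq\Theta$ and $h_1\in\Theta\setminus H_0$: a (randomized) test is a function $f:\mathcal S\to[0,1]$; $\mathrm{Size}(f,h_0)=E_{P\sim\pi_{h_0}}f(P)$, $\mathrm{Size}(f)=\sup_{h_0\in H_0}\mathrm{Size}(f,h_0)$, $\mathrm{Power}(f,h_1)=E_{P\sim\pi_{h_1}}f(P)$. A level-$\alpha$ most powerful test for $H_0$ vs. $h_1$ is a test of size $\alpha$ whose power at $h_1$ is maximal among all tests of size at most $\alpha$. For a probability distribution $\Lambda$ over $H_0$ with support $\mathrm{Spt}(\Lambda)$, let $\mathrm{Ratio}_{\Lambda,h_1}(P)=\dfrac{\pi_{h_1}(P)}{\sum_{h_0\in H_0}\Lambda(h_0)\pi_{h_0}(P)}$; all likelihood ratios involved (for $\Lambda_X,x_1$ on $\mathcal S_X$ and for $\Lambda^*,(x_1,y_1)$ on $\mathcal S_X\times\mathcal S_Y$) are assumed to be well-defined positive real numbers at every sample. For $0<\alpha<1$ the likelihood ratio test $\mathrm{LR}_{\alpha,\Lambda,h_1}(P)$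 equals $1$ if $\mathrm{Ratio}_{\Lambda,h_1}(P)>k_\alpha$, $0$ if $\mathrm{Ratio}_{\Lambda,h_1}(P)<k_\alpha$, and $\gamma_\alpha$ if equality holds, where $k_\alpha\ge0$ and $\gamma_\alpha\in[0,1]$ are chosen so that $\sum_{h_0\in H_0}\Lambda(h_0)\,\mathrm{Size}(\mathrm{LR}_{\alpha,\Lambda,h_1},h_0)=\alpha$. $\Lambda$ is a (level-$\alpha$) least favorable distribution for $H_0$ vs. $h_1$ if $\mathrm{LR}_{\alpha,\Lambda,h_1}$ is a level-$\alpha$ most powerful test for $H_0$ vs. $h_1$; by a known result this is equivalent to: (i) $\mathrm{Size}(\mathrm{LR}_{\alpha,\Lambda,h_1},h_0^* )=\alpha$ for all $h_0^*\in\mathrm{Spt}(\Lambda)$ and (ii) $\mathrm{Size}(\mathrm{LR}_{\alpha,\Lambda,h_1},h_0)\le\alpha$ for all $h_0\in H_0$. *)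

theory Defs
  imports "HOL-Probability.Probability_Mass_Function"
begin

record ('s, 't) stat_model =
  sample_space :: "'s set"
  param_space :: "'t set"
  distr_of :: "'t \<Rightarrow> 's pmf"

text \<open>Only the values of \<open>distr_of\<close> at parameters of the model matter. Every distribution on a finite
  sample space is a \<^typ>\<open>'s pmf\<close>, so discreteness is no restriction for finite models.\<close>

definition is_stat_model :: "('s, 't) stat_model \<Rightarrow> bool" where
  "is_stat_model M \<longleftrightarrow> (\<forall>\<theta>\<in>param_space M. set_pmf (distr_of M \<theta>) \<subseteq> sample_space M)"

definition finite_stat_model :: "('s, 't) stat_model \<Rightarrow> bool" where
  "finite_stat_model M \<longleftrightarrow>
     is_stat_model M \<and> finite (sample_space M) \<and> finite (param_space M)"

definition combined_model ::
  "('s, 't) stat_model \<Rightarrow> ('u, 'v) stat_model \<Rightarrow> ('s \<times> 'u, 't \<times> 'v) stat_model" where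
  "combined_model M N =
     \<lparr>sample_space = sample_space M \<times> sample_space N,
      param_space = param_space M \<times> param_space N,
      distr_of = (\<lambda>(x, y). pair_pmf (distr_of M x) (distr_of N y))\<rparr>"

definition is_test :: "('s, 't) stat_model \<Rightarrow> ('s \<Rightarrow> real) \<Rightarrow> bool" where
  "is_test M f \<longleftrightarrow> (\<forall>P\<in>sample_space M. 0 \<le> f P \<and> f P \<le> 1)"

definition size_at :: "('s, 't) stat_model \<Rightarrow> ('s \<Rightarrow> real) \<Rightarrow> 't \<Rightarrow> real" where
  "size_at M f h0 = measure_pmf.expectation (distr_of M h0) f"

text \<open>The supremum is only meaningful for nonempty \<open>H0\<close>; this is automatic wherever a
  distribution over \<open>H0\<close> is given.\<close>

definition test_size :: "('s, 't) stat_model \<Rightarrow> 't set \<Rightarrow> ('s \<Rightarrow> real) \<Rightarrow> real" where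
  "test_size M H0 f = (SUP h0\<in>H0. size_at M f h0)"

definition test_power :: "('s, 't) stat_model \<Rightarrow> ('s \<Rightarrow> real) \<Rightarrow> 't \<Rightarrow> real" where
  "test_power M f h1 = measure_pmf.expectation (distr_of M h1) f"

definition most_powerful_test ::
  "('s, 't) stat_model \<Rightarrow> real \<Rightarrow> 't set \<Rightarrow> 't \<Rightarrow> ('s \<Rightarrow> real) \<Rightarrow> bool" where
  "most_powerful_test M \<alpha> H0 h1 f \<longleftrightarrow>
     is_test M f \<and> test_size M H0 f = \<alpha> \<and>
     (\<forall>g. is_test M g \<and> test_size M H0 g \<le> \<alpha> \<longrightarrow> test_power M g h1 \<le> test_power M f h1)"

definition distribution_over :: "'t set \<Rightarrow> 't pmf \<Rightarrow> bool" where
  "distribution_over H0 \<Lambda> \<longleftrightarrow> set_pmf \<Lambda> \<subseteq> H0"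

definition mixture_prob :: "('s, 't) stat_model \<Rightarrow> 't set \<Rightarrow> 't pmf \<Rightarrow> 's \<Rightarrow> real" where
  "mixture_prob M H0 \<Lambda> P = (\<Sum>h0\<in>H0. pmf \<Lambda> h0 * pmf (distr_of M h0) P)"

definition likelihood_ratio ::
  "('s, 't) stat_model \<Rightarrow> 't set \<Rightarrow> 't pmf \<Rightarrow> 't \<Rightarrow> 's \<Rightarrow> real" where
  "likelihood_ratio M H0 \<Lambda> h1 P = pmf (distr_of M h1) P / mixture_prob M H0 \<Lambda> P"

definition positive_ratios :: "('s, 't) stat_model \<Rightarrow> 't set \<Rightarrow> 't pmf \<Rightarrow> 't \<Rightarrow> bool" where
  "positive_ratios M H0 \<Lambda> h1 \<longleftrightarrow>
     (\<forall>P\<in>sample_space M. mixture_prob M H0 \<Lambda> P \<noteq> 0 \<and> likelihood_ratio M H0 \<Lambda> h1 P > 0)"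

definition lr_test ::
  "('s, 't) stat_model \<Rightarrow> 't set \<Rightarrow> 't pmf \<Rightarrow> 't \<Rightarrow> real \<Rightarrow> real \<Rightarrow> 's \<Rightarrow> real" where
  "lr_test M H0 \<Lambda> h1 k \<gamma> P =
     (if likelihood_ratio M H0 \<Lambda> h1 P > k then 1
      else if likelihood_ratio M H0 \<Lambda> h1 P < k then 0
      else \<gamma>)"

definition admissible_cutoff ::
  "('s, 't) stat_model \<Rightarrow> real \<Rightarrow> 't set \<Rightarrow> 't pmf \<Rightarrow> 't \<Rightarrow> real \<Rightarrow> real \<Rightarrow> bool" where
  "admissible_cutoff M \<alpha> H0 \<Lambda> h1 k \<gamma> \<longleftrightarrow>
     0 \<le> k \<and> 0 \<le> \<gamma> \<and> \<gamma> \<le> 1 \<and>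
     (\<Sum>h0\<in>H0. pmf \<Lambda> h0 * size_at M (lr_test M H0 \<Lambda> h1 k \<gamma>) h0) = \<alpha>"

text \<open>Different admissible pairs \<open>(k, \<gamma>)\<close> can exist, but they all define the same test on the sample
  space when the likelihood ratios are positive reals (lemma \<open>lr_test_unique\<close> below). So ``the''
  likelihood ratio test is well defined, and quantifying existentially over the pair is harmless.\<close>

definition least_favorable ::
  "('s, 't) stat_model \<Rightarrow> real \<Rightarrow> 't set \<Rightarrow> 't \<Rightarrow> 't pmf \<Rightarrow> bool" where
  "least_favorable M \<alpha> H0 h1 \<Lambda> \<longleftrightarrow>
     distribution_over H0 \<Lambda> \<and>
     (\<exists>k \<gamma>. admissible_cutoff M \<alpha> H0 \<Lambda> h1 k \<gamma> \<and>
            most_powerful_test M \<alpha> H0 h1 (lr_test M H0 \<Lambda> h1 k \<gamma>))"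

lemma size_at_finite:
  assumes "finite_stat_model M" "h0 \<in> param_space M"
  shows "size_at M f h0 = (\<Sum>P\<in>sample_space M. f P * pmf (distr_of M h0) P)"
  unfolding size_at_def using assms
  by (intro integral_measure_pmf_real) (auto simp: finite_stat_model_def is_stat_model_def)

lemma mixture_size_finite:
  assumes "finite_stat_model M" "H0 \<subseteq> param_space M"
  shows "(\<Sum>h0\<in>H0. pmf \<Lambda> h0 * size_at M f h0) =
         (\<Sum>P\<in>sample_space M. f P * mixture_prob M H0 \<Lambda> P)"
proof -
  have "(\<Sum>h0\<in>H0. pmf \<Lambda> h0 * size_at M f h0) =
      (\<Sum>h0\<in>H0. \<Sum>P\<in>sample_space M. f P * (pmf \<Lambda> h0 * pmf (distr_of M h0) P))"
    using assms by (intro sum.cong refl) (auto simp: size_at_finite sum_distrib_left mult_ac)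
  also have "\<dots> = (\<Sum>P\<in>sample_space M. \<Sum>h0\<in>H0. f P * (pmf \<Lambda> h0 * pmf (distr_of M h0) P))"
    by (rule sum.swap)
  finally show ?thesis by (simp add: mixture_prob_def sum_distrib_left)
qed

lemma lr_test_unique:
  assumes fin: "finite_stat_model M" and sub: "H0 \<subseteq> param_space M"
    and pos: "positive_ratios M H0 \<Lambda> h1"
    and adm: "admissible_cutoff M \<alpha> H0 \<Lambda> h1 k \<gamma>" "admissible_cutoff M \<alpha> H0 \<Lambda> h1 k' \<gamma>'"
    and P: "P \<in> sample_space M"
  shows "lr_test M H0 \<Lambda> h1 k \<gamma> P = lr_test M H0 \<Lambda> h1 k' \<gamma>' P"
proof -
  let ?m = "mixture_prob M H0 \<Lambda>"
  have m: "?m Q > 0" if "Q \<in> sample_space M" for Q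
    using pos that by (auto simp: positive_ratios_def mixture_prob_def less_le intro!: sum_nonneg)
  have key: "g P = f P"
    if le: "\<And>Q. f Q \<le> g Q" and eq: "(\<Sum>Q\<in>sample_space M. f Q * ?m Q) = (\<Sum>Q\<in>sample_space M. g Q * ?m Q)"
    for f g
  proof -
    have "(\<Sum>Q\<in>sample_space M. (g Q - f Q) * ?m Q) = 0"
      using eq by (simp add: algebra_simps sum_subtractf)
    moreover have "0 \<le> (g Q - f Q) * ?m Q" if "Q \<in> sample_space M" for Q
      using le[of Q] m[OF that] by simp
    ultimately have "(g P - f P) * ?m P = 0"
      using fin P by (subst (asm) sum_nonneg_eq_0_iff) (auto simp: finite_stat_model_def)
    then show ?thesis using m[OF P] by simp
  qed
  let ?f = "lr_test M H0 \<Lambda> h1 k \<gamma>" and ?g = "lr_test M H0 \<Lambda> h1 k' \<gamma>'"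
  have eq: "(\<Sum>Q\<in>sample_space M. ?f Q * ?m Q) = (\<Sum>Q\<in>sample_space M. ?g Q * ?m Q)"
    using adm by (simp add: admissible_cutoff_def mixture_size_finite[OF fin sub])
  have "(\<forall>Q. ?f Q \<le> ?g Q) \<or> (\<forall>Q. ?g Q \<le> ?f Q)"
    using adm unfolding admissible_cutoff_def lr_test_def
    by (cases k k' rule: linorder_cases; cases "\<gamma> \<le> \<gamma>'") auto
  then show ?thesis using key[of ?f ?g] key[of ?g ?f] eq by auto
qed

end

theory Submission imports Defs begin

text \<open>
  Write \<open>\<Lambda>\<close> for \<open>\<Lambda>_X\<close>. Since \<open>\<Lambda>_star\<close> is concentrated on \<open>y1\<close>, the probability of the second sample
  coordinate under \<open>y1\<close> is a common factor of the numerator and the denominator of the likelihood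
  ratio at \<open>(P, Q)\<close>. It cancels, and what remains is the ratio of \<open>\<Lambda>\<close> at \<open>P\<close>
  (\<open>likelihood_ratio_combined_slice\<close>). So with the same cutoff the likelihood ratio test of the
  combined model looks only at the first coordinate and there agrees with the test of \<open>M_X\<close>.
  A test of this kind has the same size at \<open>(x, y)\<close> as at \<open>x\<close>, whatever \<open>y\<close> is
  (\<open>size_at_combined_fst\<close>), which is why the whole of \<open>param_space M_Y\<close> can be admitted as nuisance
  parameter and the overall size stays \<open>\<alpha>\<close>.

  For optimality, a competing test \<open>g\<close> of the combined model is turned into a test of \<open>M_X\<close> by
  averaging over the second coordinate under \<open>y1\<close>. By Fubini (\<open>size_at_combined\<close>), the averaged
  test has at \<open>x\<close> the size, and at \<open>x1\<close> the power, that \<open>g\<close> has at \<open>(x, y1)\<close> and at \<open>(x1, y1)\<close>.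
  Hence a better test in the combined model would give a better test in \<open>M_X\<close>. This
  reduction works for every most powerful test of \<open>M_X\<close>, read as a test of the combined model that
  only depends on the first coordinate (\<open>most_powerful_test_combined_fst\<close>).
\<close>

lemma param_space_combined [simp]:
  "param_space (combined_model M N) = param_space M \<times> param_space N"
  by (simp add: combined_model_def)

lemma sample_space_combined [simp]:
  "sample_space (combined_model M N) = sample_space M \<times> sample_space N"
  by (simp add: combined_model_def)

lemma distr_of_combined [simp]:
  "distr_of (combined_model M N) (x, y) = pair_pmf (distr_of M x) (distr_of N y)"
  by (simp add: combined_model_def)

lemma finite_stat_model_combined:
  assumes "finite_stat_model M" "finite_stat_model N"
  shows "finite_stat_model (combined_model M N)"
  using assms by (fastforce simp: finite_stat_model_def is_stat_model_def)

lemma sample_space_nonempty: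
  assumes "finite_stat_model M" "\<theta> \<in> param_space M"
  shows "sample_space M \<noteq> {}"
  using assms set_pmf_not_empty[of "distr_of M \<theta>"]
  by (auto simp: finite_stat_model_def is_stat_model_def)

lemma size_at_cong:
  assumes "finite_stat_model M" "\<theta> \<in> param_space M"
    and "\<And>P. P \<in> sample_space M \<Longrightarrow> f P = g P"
  shows "size_at M f \<theta> = size_at M g \<theta>"
  using assms by (simp add: size_at_finite)

lemma size_at_test_bounds:
  assumes "finite_stat_model M" "\<theta> \<in> param_space M" "is_test M f"
  shows "0 \<le> size_at M f \<theta>" "size_at M f \<theta> \<le> 1"
proof -
  have "AE P in distr_of M \<theta>. 0 \<le> f P \<and> f P \<le> 1"
    using assms by (auto simp: AE_measure_pmf_iff finite_stat_model_def is_stat_model_def is_test_def)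
  moreover have "finite (set_pmf (distr_of M \<theta>))"
    using assms by (auto simp: finite_stat_model_def is_stat_model_def intro: finite_subset)
  ultimately show "0 \<le> size_at M f \<theta>" "size_at M f \<theta> \<le> 1"
    unfolding size_at_def
    by (auto intro!: integral_nonneg_AE measure_pmf.integral_le_const integrable_measure_pmf_finite)
qed

text \<open>Fubini for the product distribution. As the power at \<open>h1\<close> is the expectation that \<open>size_at\<close>
  denotes, the lemma serves for powers as well as for sizes.\<close>

lemma size_at_combined:
  assumes "finite_stat_model M" "finite_stat_model N"
    and "x \<in> param_space M" "y \<in> param_space N"
  shows "size_at (combined_model M N) g (x, y) =
         size_at M (\<lambda>P. size_at N (\<lambda>Q. g (P, Q)) y) x"
proof -
  have "size_at (combined_model M N) g (x, y) =
      (\<Sum>P\<in>sample_space M. \<Sum>Q\<in>sample_space N.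
         g (P, Q) * (pmf (distr_of M x) P * pmf (distr_of N y) Q))"
    using assms
    by (auto simp: size_at_finite[OF finite_stat_model_combined] sum.cartesian_product
        pmf_pair intro!: sum.cong)
  also have "\<dots> = size_at M (\<lambda>P. size_at N (\<lambda>Q. g (P, Q)) y) x"
    using assms by (simp add: size_at_finite sum_distrib_left mult_ac)
  finally show ?thesis .
qed

lemma size_at_combined_fst:
  assumes "finite_stat_model M" "finite_stat_model N"
    and "x \<in> param_space M" "y \<in> param_space N"
    and "\<And>P Q. P \<in> sample_space M \<Longrightarrow> Q \<in> sample_space N \<Longrightarrow> g (P, Q) = f P"
  shows "size_at (combined_model M N) g (x, y) = size_at M f x"
proof -
  have "size_at N (\<lambda>Q. g (P, Q)) y = f P" if "P \<in> sample_space M" for P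
  proof -
    have "size_at N (\<lambda>Q. g (P, Q)) y = size_at N (\<lambda>_. f P) y"
      by (rule size_at_cong) (use assms that in auto)
    then show ?thesis by (simp add: size_at_def)
  qed
  then show ?thesis
    using assms by (simp add: size_at_combined cong: size_at_cong)
qed

text \<open>An independent observation \<open>Q\<close> of the second model cannot help to reject, because the null
  hypotheses \<open>(x, y1)\<close> give \<open>Q\<close> the same distribution as the alternative \<open>(x1, y1)\<close>. The remaining
  null hypotheses \<open>(x, y)\<close> only restrict the competing tests further, and a test that ignores \<open>Q\<close>
  meets these restrictions at no cost.\<close>

lemma most_powerful_test_combined_fst:
  assumes fin: "finite_stat_model M" "finite_stat_model N"
    and H0: "H0 \<subseteq> param_space M" "H0 \<noteq> {}"
    and x1: "x1 \<in> param_space M" and y1: "y1 \<in> param_space N"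
    and mp: "most_powerful_test M \<alpha> H0 x1 f"
    and F: "\<And>P Q. P \<in> sample_space M \<Longrightarrow> Q \<in> sample_space N \<Longrightarrow> F (P, Q) = f P"
  shows "most_powerful_test (combined_model M N) \<alpha> (H0 \<times> param_space N) (x1, y1) F"
proof -
  let ?MN = "combined_model M N" and ?H = "H0 \<times> param_space N"
  have size_F: "size_at ?MN F (x, y) = size_at M f x"
    if "x \<in> param_space M" "y \<in> param_space N" for x y
    by (rule size_at_combined_fst[OF fin that]) (rule F)
  have "size_at ?MN F ` ?H = size_at M f ` H0"
    using size_F H0 y1 by (force simp: image_iff)
  then have size: "test_size ?MN ?H F = \<alpha>"
    using mp by (simp add: test_size_def most_powerful_test_def)
  have test: "is_test ?MN F"
    using mp F by (auto simp: is_test_def most_powerful_test_def)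
  have "test_power ?MN g (x1, y1) \<le> test_power ?MN F (x1, y1)"
    if g: "is_test ?MN g" and g_size: "test_size ?MN ?H g \<le> \<alpha>" for g
  proof -
    define g' where "g' P = size_at N (\<lambda>Q. g (P, Q)) y1" for P
    have size_g': "size_at ?MN g (x, y1) = size_at M g' x" if "x \<in> param_space M" for x
      unfolding g'_def using size_at_combined[OF fin that y1] .
    have "is_test M g'"
      unfolding is_test_def g'_def
    proof
      fix P assume "P \<in> sample_space M"
      then have "is_test N (\<lambda>Q. g (P, Q))"
        using g by (auto simp: is_test_def)
      from size_at_test_bounds[OF fin(2) y1 this]
      show "0 \<le> size_at N (\<lambda>Q. g (P, Q)) y1 \<and> size_at N (\<lambda>Q. g (P, Q)) y1 \<le> 1"
        by simp
    qed
    moreover have "test_size M H0 g' \<le> \<alpha>"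
      unfolding test_size_def
    proof (rule cSUP_least)
      fix x assume x: "x \<in> H0"
      have "finite ?H"
        using fin H0 by (auto simp: finite_stat_model_def intro: finite_subset)
      then have "size_at ?MN g (x, y1) \<le> test_size ?MN ?H g"
        unfolding test_size_def using x y1 by (intro cSUP_upper) auto
      then show "size_at M g' x \<le> \<alpha>"
        using size_g' x H0 g_size by auto
    qed (rule H0)
    ultimately have "test_power M g' x1 \<le> test_power M f x1"
      using mp by (simp add: most_powerful_test_def)
    then show ?thesis
      using size_g'[OF x1] size_F[OF x1 y1] by (simp add: test_power_def size_at_def)
  qed
  with size test show ?thesis
    by (simp add: most_powerful_test_def)
qed

text \<open>Any weighted sum over the product hypothesis collapses to the slice over \<open>y1\<close>; this covers both
  the mixture in the denominator of the ratio and the averaged size that fixes the cutoff.\<close>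

lemma sum_pmf_concentrated_slice:
  fixes w :: "'t \<times> 'v \<Rightarrow> real"
  assumes "finite T" "y1 \<in> T"
    and "\<And>x. x \<in> H0 \<Longrightarrow> pmf \<Lambda>' (x, y1) = pmf \<Lambda> x"
    and "\<And>x y. x \<in> H0 \<Longrightarrow> y \<in> T \<Longrightarrow> y \<noteq> y1 \<Longrightarrow> pmf \<Lambda>' (x, y) = 0"
  shows "(\<Sum>h\<in>H0 \<times> T. pmf \<Lambda>' h * w h) = (\<Sum>x\<in>H0. pmf \<Lambda> x * w (x, y1))"
proof -
  have "(\<Sum>h\<in>H0 \<times> T. pmf \<Lambda>' h * w h) = (\<Sum>x\<in>H0. \<Sum>y\<in>T. pmf \<Lambda>' (x, y) * w (x, y))"
    by (simp add: sum.cartesian_product case_prod_unfold)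
  also have "\<dots> = (\<Sum>x\<in>H0. \<Sum>y\<in>T. if y = y1 then pmf \<Lambda> x * w (x, y1) else 0)"
    using assms by (intro sum.cong refl) auto
  also have "\<dots> = (\<Sum>x\<in>H0. pmf \<Lambda> x * w (x, y1))"
    using assms by simp
  finally show ?thesis .
qed

lemma likelihood_ratio_combined_slice:
  assumes "finite (param_space N)" "y1 \<in> param_space N"
    and "\<And>x. x \<in> H0 \<Longrightarrow> pmf \<Lambda>' (x, y1) = pmf \<Lambda> x"
    and "\<And>x y. x \<in> H0 \<Longrightarrow> y \<in> param_space N \<Longrightarrow> y \<noteq> y1 \<Longrightarrow> pmf \<Lambda>' (x, y) = 0"
    and nz: "pmf (distr_of N y1) Q \<noteq> 0"
  shows "likelihood_ratio (combined_model M N) (H0 \<times> param_space N) \<Lambda>' (x1, y1) (P, Q) =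
         likelihood_ratio M H0 \<Lambda> x1 P"
proof -
  have "mixture_prob (combined_model M N) (H0 \<times> param_space N) \<Lambda>' (P, Q) =
      mixture_prob M H0 \<Lambda> P * pmf (distr_of N y1) Q"
    unfolding mixture_prob_def
    by (subst sum_pmf_concentrated_slice[OF assms(1-4)])
       (simp_all add: pmf_pair sum_distrib_right mult.assoc)
  then show ?thesis
    using nz by (simp add: likelihood_ratio_def pmf_pair)
qed

theorem lemma6:
  fixes M_X :: "('s, 't) stat_model" and M_Y :: "('u, 'v) stat_model"
    and H0_X :: "'t set" and x1 :: 't and y1 :: 'v and \<alpha> :: real
    and \<Lambda>_X :: "'t pmf" and \<Lambda>_star :: "('t \<times> 'v) pmf"
  assumes "finite_stat_model M_X" and "finite_stat_model M_Y"
    and "H0_X \<subseteq> param_space M_X" and "x1 \<in> param_space M_X - H0_X"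
    and "0 < \<alpha>" and "\<alpha> < 1"
    and "least_favorable M_X \<alpha> H0_X x1 \<Lambda>_X"
    and "y1 \<in> param_space M_Y"
    and "distribution_over (H0_X \<times> param_space M_Y) \<Lambda>_star"
    and "\<And>x. x \<in> H0_X \<Longrightarrow> pmf \<Lambda>_star (x, y1) = pmf \<Lambda>_X x"
    and "\<And>x y. x \<in> H0_X \<Longrightarrow> y \<in> param_space M_Y \<Longrightarrow> y \<noteq> y1 \<Longrightarrow> pmf \<Lambda>_star (x, y) = 0"
    and "positive_ratios M_X H0_X \<Lambda>_X x1"
    and "positive_ratios (combined_model M_X M_Y) (H0_X \<times> param_space M_Y) \<Lambda>_star (x1, y1)"
  shows "least_favorable (combined_model M_X M_Y) \<alpha> (H0_X \<times> param_space M_Y) (x1, y1) \<Lambda>_star"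
proof -
  let ?M = "combined_model M_X M_Y" and ?H = "H0_X \<times> param_space M_Y"
  note fin = assms(1,2) and H0 = assms(3) and y1 = assms(8)
  have finY: "finite (param_space M_Y)"
    using fin by (simp add: finite_stat_model_def)
  have x1: "x1 \<in> param_space M_X"
    using assms(4) by simp
  have H0_ne: "H0_X \<noteq> {}"
    using assms(7) set_pmf_not_empty[of \<Lambda>_X]
    by (auto simp: least_favorable_def distribution_over_def)
  obtain k \<gamma> where adm: "admissible_cutoff M_X \<alpha> H0_X \<Lambda>_X x1 k \<gamma>"
    and mp: "most_powerful_test M_X \<alpha> H0_X x1 (lr_test M_X H0_X \<Lambda>_X x1 k \<gamma>)"
    using assms(7) by (auto simp: least_favorable_def)
  let ?f = "lr_test M_X H0_X \<Lambda>_X x1 k \<gamma>" and ?F = "lr_test ?M ?H \<Lambda>_star (x1, y1) k \<gamma>"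
  \<comment> \<open>A zero probability of \<open>Q\<close> under \<open>y1\<close> would make the numerator of the combined ratio vanish.\<close>
  have nz: "pmf (distr_of M_Y y1) Q \<noteq> 0" if Q: "Q \<in> sample_space M_Y" for Q
  proof -
    obtain P where "P \<in> sample_space M_X"
      using sample_space_nonempty[OF fin(1) x1] by auto
    with Q have "likelihood_ratio ?M ?H \<Lambda>_star (x1, y1) (P, Q) > 0"
      using assms(13) by (auto simp: positive_ratios_def)
    then show ?thesis
      by (auto simp: likelihood_ratio_def pmf_pair)
  qed
  have F: "?F (P, Q) = ?f P" if "P \<in> sample_space M_X" "Q \<in> sample_space M_Y" for P Q
  proof -
    have "likelihood_ratio ?M ?H \<Lambda>_star (x1, y1) (P, Q) = likelihood_ratio M_X H0_X \<Lambda>_X x1 P"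
      by (rule likelihood_ratio_combined_slice[OF finY y1])
         (use assms(10,11) nz[OF that(2)] in auto)
    then show ?thesis
      by (simp add: lr_test_def)
  qed
  have "(\<Sum>h\<in>?H. pmf \<Lambda>_star h * size_at ?M ?F h) =
      (\<Sum>x\<in>H0_X. pmf \<Lambda>_X x * size_at ?M ?F (x, y1))"
    by (rule sum_pmf_concentrated_slice[OF finY y1]) (use assms(10,11) in auto)
  also have "\<dots> = (\<Sum>x\<in>H0_X. pmf \<Lambda>_X x * size_at M_X ?f x)"
  proof (rule sum.cong[OF refl])
    fix x assume "x \<in> H0_X"
    then have "x \<in> param_space M_X"
      using H0 by auto
    then have "size_at ?M ?F (x, y1) = size_at M_X ?f x"
      by (rule size_at_combined_fst[OF fin _ y1]) (rule F)
    then show "pmf \<Lambda>_X x * size_at ?M ?F (x, y1) = pmf \<Lambda>_X x * size_at M_X ?f x"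
      by simp
  qed
  finally have "admissible_cutoff ?M \<alpha> ?H \<Lambda>_star (x1, y1) k \<gamma>"
    using adm by (simp add: admissible_cutoff_def)
  moreover have "most_powerful_test ?M \<alpha> ?H (x1, y1) ?F"
    by (rule most_powerful_test_combined_fst[OF fin H0 H0_ne x1 y1 mp]) (rule F)
  ultimately show ?thesis
    using assms(9) by (auto simp: least_favorable_def)
qed

end
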